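(* Let $p\ge2$ and $m\ge0$ be integers and $x\in[-1,1)$. Then \begin{align*} &(-1)^{p-1}\sum_{n=1}^\infty\left\{\frac{\zeta_n(p+2m)}{n^p}-\frac{\zeta_n(p)}{n^{p+2m}}\right\}\left(\sum_{k=1}^n\frac{x^k}{k}\right)\\ &=\sum_{i=1}^{p+2m-1}(-1)^{i-1}\mathrm{Li}_{p+2m+1-i}(x)\sum_{n=1}^\infty\frac{\zeta_n(p)}{n^i}x^n-\sum_{i=1}^{p-1}(-1)^{i-1}\mathrm{Li}_{p+1-i}(x)\sum_{n=1}^\infty\frac{\zeta_n(p+2m)}{n^i}x^n\\ &\quad+(-1)^p\ln(1-x)\sum_{n=1}^\infty\left\{\frac{\zeta_n(p+2m)}{n^p}-\frac{\zeta_n(p)}{n^{p+2m}}\right\}(1-x^n). \end{align*}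
   Context: For positive integers $k,n$, $\zeta_n(k)=\sum_{j=1}^n j^{-k}$. The polylogarithm is $\mathrm{Li}_s(x)=\sum_{n\ge1}x^n/n^s$ for $|x|\le1$, $s\ge2$. *)

theory Defs
  imports Complex_Main
begin

definition zeta_partial :: "nat \<Rightarrow> nat \<Rightarrow> real" where
  "zeta_partial n k = (\<Sum>j=1..n. 1 / real j ^ k)"

(* Intended for s \<ge> 2 and \<bar>x\<bar> \<le> 1, where the series converges; the term with index n is the
   (n + 1)-st term of the usual series. *)
definition Li :: "nat \<Rightarrow> real \<Rightarrow> real" where
  "Li s x = (\<Sum>n. x ^ Suc n / real (Suc n) ^ s)"

end

theory Submission
  imports Defs "HOL-Analysis.Analysis"
begin

text \<open>
  Write \<open>\<zeta>(n, p)\<close> for the \<open>n\<close>-th partial zeta sum and let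
  \<open>J(n, s) = \<integral>\<^bsub>0\<^esub>\<^bsup>x\<^esup> t\<^bsup>n-1\<^esup> Li\<^bsub>s\<^esub>(t) dt = \<Sum>\<^bsub>j\<ge>1\<^esub> x\<^bsup>n+j\<^esup> / (j\<^bsup>s\<^esup> (n + j))\<close>.
  For \<open>\<bar>x\<bar> < 1\<close>, grouping \<open>\<Sum>\<^bsub>n\<^esub> \<zeta>(n, p) J(n, q)\<close> by \<open>N = n + j\<close>, the coefficient of
  \<open>x\<^bsup>N\<^esup> / N\<close> is the sum of \<open>1 / (l\<^bsup>p\<^esup> j\<^bsup>q\<^esup>)\<close> over \<open>l + j \<le> N\<close>, so the double series is
  symmetric in \<open>p\<close> and \<open>q\<close>. Partial fractions reduce \<open>J(n, q)\<close> to \<open>J(n, 1)\<close>, which is elementary,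
  and for \<open>p\<close> and \<open>q\<close> of equal parity the symmetry becomes the claimed identity. The endpoint
  \<open>x = -1\<close> follows by continuity: the conditionally convergent power series have coefficients
  of bounded variation, so multiplying by \<open>1 - x\<close> makes them absolutely convergent.
\<close>

section \<open>Auxiliary series and the partial-fraction expansion of the moments\<close>

definition zeta_power_series :: "nat \<Rightarrow> nat \<Rightarrow> real \<Rightarrow> real" where
  "zeta_power_series a b x = (\<Sum>n. zeta_partial (Suc n) a / real (Suc n) ^ b * x ^ Suc n)"

text \<open>For \<open>\<bar>x\<bar> < 1\<close> and \<open>n > 0\<close> this is \<open>n\<close>
  times J(n, 1): integrating t^(n-1) * (- ln (1 - t)) by parts from 0 to x gives this closed
  form.\<close>

definition log_remainder :: "nat \<Rightarrow> real \<Rightarrow> real" where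
  "log_remainder n x = (1 - x ^ n) * ln (1 - x) + (\<Sum>k=1..n. x ^ k / real k)"

text \<open>The quantity \<open>J(n, s)\<close> above, as a series.\<close>

definition moment :: "nat \<Rightarrow> nat \<Rightarrow> real \<Rightarrow> real" where
  "moment n s x = (\<Sum>j. x ^ (n + Suc j) / (real (Suc j) ^ s * real (n + Suc j)))"

lemma summable_power_div:
  fixes x :: real
  assumes "\<bar>x\<bar> < 1" and "\<And>j. d j \<ge> 1"
  shows "summable (\<lambda>j. x ^ (n + Suc j) / d j)"
proof (rule summable_comparison_test')
  show "summable (\<lambda>j. \<bar>x\<bar> ^ j)"
    using assms(1) by (intro summable_geometric) auto
  fix j :: nat
  have "\<bar>x\<bar> ^ (n + Suc j) \<le> \<bar>x\<bar> ^ j"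
    using assms(1) by (intro power_decreasing) auto
  moreover have "\<bar>x\<bar> ^ (n + Suc j) / d j \<le> \<bar>x\<bar> ^ (n + Suc j) / 1"
    using assms(2)[of j] by (intro divide_left_mono) auto
  ultimately have "\<bar>x\<bar> ^ (n + Suc j) / d j \<le> \<bar>x\<bar> ^ j" by simp
  then show "norm (x ^ (n + Suc j) / d j) \<le> \<bar>x\<bar> ^ j"
    using assms(2)[of j] by (simp add: power_abs abs_mult)
qed

lemma one_le_power_mult: "1 \<le> real (Suc j) ^ s * real (n + Suc j)"
  using mult_mono[of 1 "real (Suc j) ^ s" 1 "real (n + Suc j)"] by (simp del: of_nat_Suc)

text \<open>This is 1 / (a * (b + a)) = (1 / a - 1 / (b + a)) / b, multiplied by
  \<open>c / a ^ s\<close>. With a = j and b = n it lowers the power of j by one.\<close>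

lemma partial_fraction_step:
  fixes a b c :: real
  assumes "a > 0" and "b > 0"
  shows "c / (a ^ Suc s * (b + a)) = c / (b * a ^ Suc s) - c / (a ^ s * (b + a)) / b"
proof -
  define d where "d = b + a"
  have "d > 0" "c * d = a * c + b * c" using assms by (auto simp: d_def algebra_simps)
  then show ?thesis
    unfolding d_def[symmetric] using assms by (simp add: field_simps)
qed

text \<open>The partial fraction is applied to each term and summed over j. In the integral picture
  this is one integration by parts.\<close>

lemma moment_Suc:
  assumes "\<bar>x\<bar> < 1" and "n > 0"
  shows "moment n (Suc s) x = x ^ n / real n * Li (Suc s) x - moment n s x / real n"
proof -
  have sL: "summable (\<lambda>j. x ^ Suc j / real (Suc j) ^ Suc s)"
    using summable_power_div[OF assms(1), of "\<lambda>j. real (Suc j) ^ Suc s" 0]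
    by (simp add: one_le_power del: of_nat_Suc power_Suc)
  have sM: "summable (\<lambda>j. x ^ (n + Suc j) / (real (Suc j) ^ s * real (n + Suc j)))"
    by (rule summable_power_div[OF assms(1) one_le_power_mult])
  have eq: "x ^ (n + Suc j) / (real (Suc j) ^ Suc s * real (n + Suc j)) =
      x ^ n / real n * (x ^ Suc j / real (Suc j) ^ Suc s)
      - x ^ (n + Suc j) / (real (Suc j) ^ s * real (n + Suc j)) / real n" for j
  proof -
    have "x ^ (n + Suc j) / (real (Suc j) ^ Suc s * real (n + Suc j)) =
        x ^ (n + Suc j) / (real n * real (Suc j) ^ Suc s)
        - x ^ (n + Suc j) / (real (Suc j) ^ s * real (n + Suc j)) / real n"
      unfolding of_nat_add by (rule partial_fraction_step) (use assms(2) in auto)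
    then show ?thesis by (simp only: power_add times_divide_times_eq)
  qed
  show ?thesis
    unfolding moment_def Li_def eq suminf_mult[OF sL, symmetric] suminf_divide[OF sM, symmetric]
    by (intro suminf_diff[symmetric] summable_mult summable_divide sL sM)
qed

lemma ln_one_minus_sums:
  fixes x :: real
  assumes "\<bar>x\<bar> < 1"
  shows "(\<lambda>j. x ^ Suc j / real (Suc j)) sums (- ln (1 - x))"
proof -
  have "ln (1 - x) = (\<Sum>j. - (x ^ Suc j / real (Suc j)))"
  proof -
    have "(-1) ^ j * (1 / real (j + 1)) * (1 - x - 1) ^ Suc j = - (x ^ Suc j / real (Suc j))" for j
    proof -
      have "(-1) ^ j * (1 - x - 1) ^ Suc j = - (x ^ Suc j)"
        by (simp add: power_mult_distrib[symmetric])
      then show ?thesis by (simp add: field_simps)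
    qed
    moreover have "ln (1 - x) = (\<Sum>j. (-1) ^ j * (1 / real (j + 1)) * (1 - x - 1) ^ Suc j)"
      using assms by (intro ln_series) auto
    ultimately show ?thesis by (simp only:)
  qed
  moreover have s: "summable (\<lambda>j. x ^ Suc j / real (Suc j))"
    using summable_power_div[OF assms, of "\<lambda>j. real (Suc j)" 0] by simp
  ultimately show ?thesis
    using suminf_minus[OF s] summable_sums[OF s] by simp
qed

text \<open>Partial fractions split the sum into \<open>x ^ n\<close> times the full logarithm
  series minus the tail of that series beyond \<open>x ^ n / n\<close>. Both have closed
  forms.\<close>

lemma moment_1:
  assumes "\<bar>x\<bar> < 1" and "n > 0"
  shows "moment n 1 x = log_remainder n x / real n"
proof -
  have s1: "(\<lambda>j. x ^ n * (x ^ Suc j / real (Suc j))) sums (x ^ n * - ln (1 - x))"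
    by (intro sums_mult ln_one_minus_sums assms)
  have "(\<lambda>j. x ^ Suc (j + n) / real (Suc (j + n))) sums
      (- ln (1 - x) - (\<Sum>k<n. x ^ Suc k / real (Suc k)))"
    by (rule sums_split_initial_segment[OF ln_one_minus_sums[OF assms(1)]])
  moreover have "(\<Sum>k<n. x ^ Suc k / real (Suc k)) = (\<Sum>k=1..n. x ^ k / real k)"
    using sum.atLeast1_atMost_eq[of "\<lambda>k. x ^ k / real k" n] by simp
  ultimately have s2: "(\<lambda>j. x ^ (n + Suc j) / real (n + Suc j)) sums
      (- ln (1 - x) - (\<Sum>k=1..n. x ^ k / real k))"
    by (simp add: add.commute)
  \<comment> \<open>The partial fraction at exponent 0: the remaining factor
    \<open>real (Suc j) ^ 0\<close> is 1, so no power of j is left in the tail.\<close>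
  have eq: "x ^ (n + Suc j) / (real (Suc j) * real (n + Suc j)) =
     (x ^ n * (x ^ Suc j / real (Suc j)) - x ^ (n + Suc j) / real (n + Suc j)) / real n" for j
  proof -
    have "x ^ (n + Suc j) / (real (Suc j) ^ Suc 0 * real (n + Suc j)) =
        x ^ (n + Suc j) / (real n * real (Suc j) ^ Suc 0)
        - x ^ (n + Suc j) / (real (Suc j) ^ 0 * real (n + Suc j)) / real n"
      unfolding of_nat_add by (rule partial_fraction_step) (use assms(2) in auto)
    then show ?thesis
      by (simp only: power_add diff_divide_distrib times_divide_eq_right divide_divide_eq_left
          power_0 power_Suc mult_1 mult_1_right mult.commute[of "real n"])
  qed
  have "(\<lambda>j. x ^ (n + Suc j) / (real (Suc j) * real (n + Suc j))) sums
     ((x ^ n * - ln (1 - x) - (- ln (1 - x) - (\<Sum>k=1..n. x ^ k / real k))) / real n)"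
    unfolding eq by (intro sums_divide sums_diff s1 s2)
  then show ?thesis
    unfolding moment_def log_remainder_def by (simp add: sums_iff algebra_simps)
qed

text \<open>Iterating \<open>moment_Suc\<close> down to \<open>moment_1\<close> contributes one
  polylogarithm per step, with a factor -1/n each time; this gives the alternating signs and the
  powers of n.\<close>

lemma moment_expansion:
  assumes "\<bar>x\<bar> < 1" and "n > 0"
  shows "moment n (Suc s) x =
    (\<Sum>i=1..s. (-1) ^ (i - 1) * Li (Suc s + 1 - i) x * (x ^ n / real n ^ i))
    + (-1) ^ s * log_remainder n x / real n ^ Suc s"
proof (induction s)
  case 0
  then show ?case using moment_1[OF assms] by simp
next
  case (Suc s)
  let ?f = "\<lambda>i. (-1) ^ (i - 1) * Li (Suc (Suc s) + 1 - i) x * (x ^ n / real n ^ i)"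
  \<comment> \<open>The term i = 1 is the polylogarithm from the newest application of
    \<open>moment_Suc\<close>; the others, shifted by one, are the previous sum times -1/n.\<close>
  have "(\<Sum>i=1..Suc s. ?f i) = ?f 1 + (\<Sum>i=1..s. ?f (Suc i))"
    using sum.atLeast_Suc_atMost[of 1 "Suc s" ?f] sum.atLeast_Suc_atMost_Suc_shift[of ?f 1 s]
    by simp
  also have "(\<Sum>i=1..s. ?f (Suc i)) =
      - (\<Sum>i=1..s. (-1) ^ (i - 1) * Li (Suc s + 1 - i) x * (x ^ n / real n ^ i)) / real n"
    unfolding sum_divide_distrib sum_negf[symmetric]
  proof (rule sum.cong[OF refl])
    fix i assume "i \<in> {1..s}"
    then obtain k where "i = Suc k" by (cases i) auto
    then show "?f (Suc i) = - ((-1) ^ (i - 1) * Li (Suc s + 1 - i) x * (x ^ n / real n ^ i)) / real n"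
      using assms(2) by (simp add: field_simps)
  qed
  finally have sum_eq: "(\<Sum>i=1..Suc s. ?f i) = ?f 1
      - (\<Sum>i=1..s. (-1) ^ (i - 1) * Li (Suc s + 1 - i) x * (x ^ n / real n ^ i)) / real n"
    by simp
  show ?case
    unfolding moment_Suc[OF assms, of "Suc s"] Suc.IH sum_eq
    by (simp add: add_divide_distrib mult_ac)
qed

section \<open>Rearrangement of the double series and its symmetry\<close>

lemma suminf_eq_infsum:
  fixes f :: "nat \<Rightarrow> real"
  assumes "f summable_on UNIV"
  shows "suminf f = infsum f UNIV"
  using has_sum_imp_sums[OF has_sum_infsum[OF assms]] by (simp add: sums_iff)

text \<open>Unconditional summability allows the reindexing (n, j) to (n + j, n), a bijection onto
  the pairs (N, k) with k at most N.\<close>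

lemma suminf_suminf_eq_antidiagonal:
  fixes f :: "nat \<Rightarrow> nat \<Rightarrow> real"
  assumes "(\<lambda>(n, j). f n j) summable_on UNIV \<times> UNIV"
  shows "(\<Sum>n. \<Sum>j. f n j) = (\<Sum>N. \<Sum>k\<le>N. f k (N - k))"
proof -
  let ?D = "SIGMA N:UNIV. {..N::nat}"
  have inner: "(\<lambda>j. f n j) summable_on UNIV" for n
    using summable_on_SigmaD1[of f UNIV "\<lambda>_. UNIV" n] assms by simp
  have outer: "(\<lambda>n. \<Sum>\<^sub>\<infinity>j. f n j) summable_on UNIV"
    using summable_on_Sigma_banach[of f UNIV "\<lambda>_. UNIV"] assms by simp
  have diag: "(\<lambda>(N, k). f k (N - k)) summable_on ?D \<longleftrightarrow> (\<lambda>(n, j). f n j) summable_on UNIV \<times> UNIV"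
    by (rule summable_on_reindex_bij_witness[of _ "\<lambda>(n, j). (n + j, n)" "\<lambda>(N, k). (k, N - k)"]) auto
  then have sd: "(\<lambda>(N, k). f k (N - k)) summable_on ?D" using assms by simp
  have outer': "(\<lambda>N. \<Sum>k\<le>N. f k (N - k)) summable_on UNIV"
    using summable_on_Sigma_banach[OF sd] by (simp add: infsum_finite)
  have "(\<Sum>n. \<Sum>j. f n j) = (\<Sum>\<^sub>\<infinity>n. \<Sum>\<^sub>\<infinity>j. f n j)"
    by (simp add: suminf_eq_infsum[OF inner] suminf_eq_infsum[OF outer])
  also have "\<dots> = infsum (\<lambda>(n, j). f n j) (UNIV \<times> UNIV)"
    using infsum_Sigma'_banach[OF assms] by simp
  also have "\<dots> = infsum (\<lambda>(N, k). f k (N - k)) ?D"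
    by (rule infsum_reindex_bij_witness[of _ "\<lambda>(N, k). (k, N - k)" "\<lambda>(n, j). (n + j, n)"]) auto
  also have "\<dots> = (\<Sum>\<^sub>\<infinity>N. \<Sum>k\<le>N. f k (N - k))"
    using infsum_Sigma'_banach[OF sd] by (simp add: infsum_finite)
  also have "\<dots> = (\<Sum>N. \<Sum>k\<le>N. f k (N - k))"
    by (simp add: suminf_eq_infsum[OF outer'])
  finally show ?thesis .
qed

lemma zeta_partial_Suc_eq: "zeta_partial (Suc n) a = (\<Sum>k=0..n. 1 / real (Suc k) ^ a)"
  unfolding zeta_partial_def using sum.atLeast_Suc_atMost_Suc_shift[of "\<lambda>k. 1 / real k ^ a" 0 n]
  by simp

text \<open>Multiplying a generating function by 1 / (1 - X), here \<open>U\<close>, forms partial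
  sums. Both sides are thus the N-th coefficient of the same product of \<open>A p\<close>,
  \<open>A q\<close> and \<open>U\<close>.\<close>

lemma zeta_partial_convolution_commute:
  "(\<Sum>k\<le>N. zeta_partial (Suc k) p / real (Suc (N - k)) ^ q) =
   (\<Sum>k\<le>N. zeta_partial (Suc k) q / real (Suc (N - k)) ^ p)"
proof -
  define A where "A s = Abs_fps (\<lambda>n. 1 / real (Suc n) ^ s)" for s
  define U :: "real fps" where "U = Abs_fps (\<lambda>_. 1)"
  have "fps_nth ((A s * U) * A t) N = (\<Sum>k\<le>N. zeta_partial (Suc k) s / real (Suc (N - k)) ^ t)" for s t
    by (simp add: fps_mult_nth A_def U_def zeta_partial_Suc_eq atMost_atLeast0)
  moreover have "(A p * U) * A q = (A q * U) * A p" by (simp only: mult_ac)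
  ultimately show ?thesis by metis
qed

lemma zeta_partial_nonneg: "0 \<le> zeta_partial n a"
  by (auto simp: zeta_partial_def intro!: sum_nonneg)

lemma zeta_partial_le: "zeta_partial n a \<le> real n"
proof -
  have "zeta_partial n a \<le> (\<Sum>j=1..n. 1)"
    unfolding zeta_partial_def by (intro sum_mono) (auto simp: divide_le_eq)
  then show ?thesis by simp
qed

text \<open>On each antidiagonal the power of x and the denominator n + j are constant; what remains
  is the convolution that is symmetric in \<open>p\<close> and \<open>q\<close>.\<close>

lemma zeta_moment_suminf_commute:
  fixes x :: real
  assumes "\<bar>x\<bar> < 1"
  shows "(\<Sum>n. zeta_partial (Suc n) p * moment (Suc n) q x) =
         (\<Sum>n. zeta_partial (Suc n) q * moment (Suc n) p x)"
proof -
  define f where "f p q n j =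
    zeta_partial (Suc n) p * (x ^ (Suc n + Suc j) / (real (Suc j) ^ q * real (Suc n + Suc j)))"
    for p q n j
  have sf: "(\<lambda>(n, j). f p q n j) summable_on UNIV \<times> UNIV" for p q
  proof -
    have 1: "(\<lambda>n. real (Suc n) * \<bar>x\<bar> ^ n) summable_on UNIV"
    proof -
      have "summable (\<lambda>n. real (Suc n) * \<bar>x\<bar> ^ n)"
        using sums_summable[OF geometric_deriv_sums[of "\<bar>x\<bar>"]] assms by simp
      then show ?thesis by (subst summable_on_UNIV_nonneg_real_iff) auto
    qed
    have 2: "(\<lambda>n. \<bar>x\<bar> ^ n) summable_on UNIV"
      using assms by (subst summable_on_UNIV_nonneg_real_iff) (auto intro!: summable_geometric)
    \<comment> \<open>The majorant comes from \<open>zeta_partial_le\<close>. It is a product of a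
      differentiated geometric series in n and a geometric series in j.\<close>
    have "(\<lambda>(n, j). real (Suc n) * \<bar>x\<bar> ^ n * \<bar>x\<bar> ^ j) summable_on UNIV \<times> UNIV"
    proof (rule summable_on_SigmaI)
      show "((\<lambda>j. case (n, j) of (n, j) \<Rightarrow> real (Suc n) * \<bar>x\<bar> ^ n * \<bar>x\<bar> ^ j) has_sum
          (real (Suc n) * \<bar>x\<bar> ^ n * (\<Sum>\<^sub>\<infinity>j. \<bar>x\<bar> ^ j))) UNIV" for n
        using has_sum_cmult_right[OF has_sum_infsum[OF 2]] by simp
      show "(\<lambda>n. real (Suc n) * \<bar>x\<bar> ^ n * (\<Sum>\<^sub>\<infinity>j. \<bar>x\<bar> ^ j)) summable_on UNIV"
        by (intro summable_on_cmult_left 1)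
    qed auto
    then have "(\<lambda>z. norm (case z of (n, j) \<Rightarrow> f p q n j)) summable_on UNIV \<times> UNIV"
    proof (rule summable_on_comparison_test)
      fix z :: "nat \<times> nat"
      obtain n j where z: "z = (n, j)" by (cases z)
      have "\<bar>x\<bar> ^ (Suc n + Suc j) / (real (Suc j) ^ q * real (Suc n + Suc j))
          \<le> \<bar>x\<bar> ^ (Suc n + Suc j) / 1"
        using one_le_power_mult[of j q "Suc n"] by (intro divide_left_mono zero_le_power) auto
      also have "\<dots> \<le> \<bar>x\<bar> ^ (n + j)"
        using assms by (simp del: power_Suc) (intro power_decreasing, auto)
      finally have "zeta_partial (Suc n) p *
          (\<bar>x\<bar> ^ (Suc n + Suc j) / (real (Suc j) ^ q * real (Suc n + Suc j)))
          \<le> real (Suc n) * \<bar>x\<bar> ^ (n + j)"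
        by (intro mult_mono zeta_partial_le) auto
      then show "norm (case z of (n, j) \<Rightarrow> f p q n j) \<le>
          (case z of (n, j) \<Rightarrow> real (Suc n) * \<bar>x\<bar> ^ n * \<bar>x\<bar> ^ j)"
        by (simp add: z f_def abs_mult power_abs zeta_partial_nonneg power_add mult.assoc
            del: of_nat_Suc of_nat_add)
    qed auto
    then show ?thesis by (rule abs_summable_summable)
  qed
  have eq: "(\<Sum>n. zeta_partial (Suc n) p * moment (Suc n) q x) = (\<Sum>N. \<Sum>k\<le>N. f p q k (N - k))" for p q
  proof -
    have "(\<Sum>n. zeta_partial (Suc n) p * moment (Suc n) q x) = (\<Sum>n. \<Sum>j. f p q n j)"
      unfolding moment_def f_def
      by (intro suminf_cong suminf_mult[symmetric] summable_power_div assms one_le_power_mult)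
    also have "\<dots> = (\<Sum>N. \<Sum>k\<le>N. f p q k (N - k))"
      by (rule suminf_suminf_eq_antidiagonal[OF sf])
    finally show ?thesis .
  qed
  \<comment> \<open>Both indices are shifted to start at 0, so the antidiagonal N carries the
    exponent N + 2.\<close>
  have "(\<Sum>k\<le>N. f p q k (N - k)) = x ^ (N + 2) / real (N + 2) *
      (\<Sum>k\<le>N. zeta_partial (Suc k) p / real (Suc (N - k)) ^ q)" for p q N
    unfolding sum_distrib_left
  proof (rule sum.cong[OF refl])
    fix k assume "k \<in> {..N}"
    then have "Suc k + Suc (N - k) = N + 2" by auto
    then show "f p q k (N - k) =
        x ^ (N + 2) / real (N + 2) * (zeta_partial (Suc k) p / real (Suc (N - k)) ^ q)"
      unfolding f_def by (simp only:) (simp add: field_simps del: of_nat_Suc of_nat_add)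
  qed
  then show ?thesis
    unfolding eq using zeta_partial_convolution_commute[of p _ q] by simp
qed

section \<open>Power series with coefficients of bounded variation on [-1, 1)\<close>

lemma continuous_on_suminf:
  fixes f :: "nat \<Rightarrow> 'a::topological_space \<Rightarrow> 'b::banach"
  assumes "\<And>n. continuous_on A (f n)" and "\<And>n x. x \<in> A \<Longrightarrow> norm (f n x) \<le> M n" and "summable M"
  shows "continuous_on A (\<lambda>x. \<Sum>n. f n x)"
proof (rule uniform_limit_theorem)
  show "uniform_limit A (\<lambda>n x. \<Sum>i<n. f i x) (\<lambda>x. \<Sum>n. f n x) sequentially"
    by (rule Weierstrass_m_test) (use assms in auto)
  show "\<forall>\<^sub>F n in sequentially. continuous_on A (\<lambda>x. \<Sum>i<n. f i x)"
    by (intro always_eventually allI continuous_on_sum assms(1))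
qed simp

lemma abs_mult_power_le:
  fixes c x :: real
  assumes "x \<in> {-1..1}"
  shows "\<bar>c * x ^ n\<bar> \<le> \<bar>c\<bar>"
proof -
  have "\<bar>x\<bar> ^ n \<le> 1" using assms by (intro power_le_one) auto
  then show ?thesis by (simp add: abs_mult power_abs mult_left_le)
qed

text \<open>Summation by parts: multiplying by \<open>1 - x\<close> replaces the coefficients by
  their differences, which are absolutely summable. This yields convergence even at x = -1, where
  the original series may converge only conditionally.\<close>

lemma bounded_variation_power_series_sums:
  fixes c :: "nat \<Rightarrow> real"
  assumes "c \<longlonglongrightarrow> 0" and bv: "summable (\<lambda>n. \<bar>c (Suc n) - c n\<bar>)" and x: "x \<in> {-1..<1}"
  shows "(\<lambda>n. c n * x ^ Suc n) sums
    ((c 0 * x + (\<Sum>n. (c (Suc n) - c n) * x ^ (n + 2))) / (1 - x))"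
proof -
  let ?d = "\<lambda>n. (c (Suc n) - c n) * x ^ (n + 2)"
  have "summable ?d"
    by (rule summable_comparison_test'[OF bv]) (use x in \<open>auto intro!: abs_mult_power_le simp del: power_Suc\<close>)
  then have "(\<lambda>N. \<Sum>n<N. ?d n) \<longlonglongrightarrow> (\<Sum>n. ?d n)"
    using summable_LIMSEQ by blast
  \<comment> \<open>This is the boundary term of the summation by parts.\<close>
  moreover have "(\<lambda>N. c N * x ^ Suc N) \<longlonglongrightarrow> 0"
    by (rule Lim_null_comparison[OF _ tendsto_rabs_zero[OF assms(1)]])
       (use x in \<open>auto intro!: always_eventually abs_mult_power_le simp del: power_Suc\<close>)
  ultimately have "(\<lambda>N. (c 0 * x + (\<Sum>n<N. ?d n) - c N * x ^ Suc N) / (1 - x)) \<longlonglongrightarrow>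
      (c 0 * x + (\<Sum>n. ?d n) - 0) / (1 - x)"
    using x by (intro tendsto_intros) auto
  moreover have "(c 0 * x + (\<Sum>n<N. ?d n) - c N * x ^ Suc N) / (1 - x) = (\<Sum>n<N. c n * x ^ Suc n)" for N
  proof -
    have "c 0 * x + (\<Sum>n<N. ?d n) - c N * x ^ Suc N = (1 - x) * (\<Sum>n<N. c n * x ^ Suc n)"
      by (induction N) (auto simp: algebra_simps)
    then show ?thesis using x by simp
  qed
  ultimately show ?thesis by (simp add: sums_def)
qed

text \<open>The difference series converges uniformly, and the division by \<open>1 - x\<close> is
  harmless because 1 is excluded.\<close>

lemma bounded_variation_power_series_continuous:
  fixes c :: "nat \<Rightarrow> real"
  assumes "c \<longlonglongrightarrow> 0" and bv: "summable (\<lambda>n. \<bar>c (Suc n) - c n\<bar>)"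
  shows "continuous_on {-1..<1} (\<lambda>x. \<Sum>n. c n * x ^ Suc n)"
proof -
  have "continuous_on {-1..<1} (\<lambda>x. \<Sum>n. (c (Suc n) - c n) * x ^ (n + 2))"
    by (rule continuous_on_suminf[OF _ _ bv])
       (auto intro!: continuous_intros abs_mult_power_le simp del: power_Suc)
  then have "continuous_on {-1..<1}
      (\<lambda>x. (c 0 * x + (\<Sum>n. (c (Suc n) - c n) * x ^ (n + 2))) / (1 - x))"
    by (intro continuous_intros) auto
  then show ?thesis
    by (rule continuous_on_eq)
       (use bounded_variation_power_series_sums[OF assms] in \<open>simp add: sums_iff\<close>)
qed

section \<open>Continuity of the polylogarithms and of the series with zeta coefficients\<close>

lemma summable_inverse_power_Suc:
  assumes "s \<ge> 2"
  shows "summable (\<lambda>n. 1 / real (Suc n) ^ s)"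
  using inverse_power_summable[OF assms, where 'a = real]
  by (subst summable_Suc_iff) (simp add: field_simps)

lemma zeta_partial_bounded:
  assumes "a \<ge> 2"
  obtains Z where "\<And>n. zeta_partial n a \<le> Z"
proof
  fix n
  have "zeta_partial n a = (\<Sum>k<n. 1 / real (Suc k) ^ a)"
    using sum.atLeast1_atMost_eq[of "\<lambda>k. 1 / real k ^ a" n] by (simp add: zeta_partial_def)
  also have "\<dots> \<le> (\<Sum>k. 1 / real (Suc k) ^ a)"
    by (intro sum_le_suminf summable_inverse_power_Suc assms) auto
  finally show "zeta_partial n a \<le> (\<Sum>k. 1 / real (Suc k) ^ a)" .
qed

lemma zeta_coeff_tendsto_0:
  assumes "a \<ge> 2" and "b \<ge> 1"
  shows "(\<lambda>n. zeta_partial (Suc n) a / real (Suc n) ^ b) \<longlonglongrightarrow> 0"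
proof -
  obtain Z where Z: "zeta_partial n a \<le> Z" for n using zeta_partial_bounded[OF assms(1)] by blast
  have "(\<lambda>n. Z * (1 / real (Suc n))) \<longlonglongrightarrow> Z * 0"
    by (intro tendsto_intros) (use LIMSEQ_inverse_real_of_nat in \<open>simp add: inverse_eq_divide\<close>)
  then have "(\<lambda>n. Z * (1 / real (Suc n))) \<longlonglongrightarrow> 0" by simp
  moreover have "norm (zeta_partial (Suc n) a / real (Suc n) ^ b) \<le> Z * (1 / real (Suc n))" for n
  proof -
    have "real (Suc n) ^ 1 \<le> real (Suc n) ^ b" by (intro power_increasing assms) auto
    then have "zeta_partial (Suc n) a / real (Suc n) ^ b \<le> Z / real (Suc n)"
      using Z[of "Suc n"] zeta_partial_nonneg[of "Suc n" a] by (intro frac_le) auto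
    then show ?thesis by (simp add: zeta_partial_nonneg)
  qed
  ultimately show ?thesis by (rule Lim_null_comparison[OF always_eventually[OF allI], rotated])
qed

text \<open>The coefficient is a product of a bounded increasing sequence with summable increments
  and a decreasing null sequence, whose differences telescope. The argument covers b = 1, where the
  coefficients themselves are not summable.\<close>

lemma zeta_coeff_bounded_variation:
  assumes "a \<ge> 2" and "b \<ge> 1"
  shows "summable (\<lambda>n. \<bar>zeta_partial (Suc (Suc n)) a / real (Suc (Suc n)) ^ b
    - zeta_partial (Suc n) a / real (Suc n) ^ b\<bar>)"
proof -
  obtain Z where Z: "zeta_partial n a \<le> Z" for n using zeta_partial_bounded[OF assms(1)] by blast
  let ?v = "\<lambda>n. 1 / real (Suc n) ^ b"
  have "?v \<longlonglongrightarrow> 0"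
    using assms(2) tendsto_power[OF LIMSEQ_inverse_real_of_nat, of b]
    by (simp add: inverse_eq_divide power_divide power_0_left)
  then have "summable (\<lambda>n. ?v n - ?v (Suc n))" by (rule telescope_summable')
  moreover have "summable (\<lambda>n. 1 / real (Suc (Suc n)) ^ a)"
    using summable_inverse_power_Suc[OF assms(1)] by (subst summable_Suc_iff)
  ultimately have "summable (\<lambda>n. 1 / real (Suc (Suc n)) ^ a + Z * (?v n - ?v (Suc n)))"
    by (intro summable_add summable_mult)
  then show ?thesis
  proof (rule summable_comparison_test')
    fix n :: nat
    define u where "u = 1 / real (Suc (Suc n)) ^ a"
    have step: "zeta_partial (Suc (Suc n)) a = zeta_partial (Suc n) a + u"
      by (simp add: zeta_partial_def u_def)
    have v: "0 \<le> ?v (Suc n)" "?v (Suc n) \<le> 1" by (auto simp: divide_le_eq)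
    have dec: "?v (Suc n) \<le> ?v n" by (intro divide_left_mono power_mono) auto
    have "u \<ge> 0" by (simp add: u_def)
    \<comment> \<open>Product rule for differences: one part is controlled by the increment
      \<open>u\<close>, the other by the bound \<open>Z\<close> times a telescoping
      difference.\<close>
    have eq: "zeta_partial (Suc (Suc n)) a / real (Suc (Suc n)) ^ b - zeta_partial (Suc n) a / real (Suc n) ^ b
        = u * ?v (Suc n) - zeta_partial (Suc n) a * (?v n - ?v (Suc n))"
      unfolding step by (simp add: algebra_simps add_divide_distrib)
    have "u * ?v (Suc n) \<le> u" using v(2) \<open>u \<ge> 0\<close> by (rule mult_left_le)
    moreover have "0 \<le> u * ?v (Suc n)" using \<open>u \<ge> 0\<close> v(1) by (rule mult_nonneg_nonneg)
    moreover have "zeta_partial (Suc n) a * (?v n - ?v (Suc n)) \<le> Z * (?v n - ?v (Suc n))"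
      using dec by (intro mult_right_mono Z) linarith
    moreover have "0 \<le> zeta_partial (Suc n) a * (?v n - ?v (Suc n))"
      using dec by (intro mult_nonneg_nonneg zeta_partial_nonneg) linarith
    ultimately show "norm \<bar>zeta_partial (Suc (Suc n)) a / real (Suc (Suc n)) ^ b
        - zeta_partial (Suc n) a / real (Suc n) ^ b\<bar>
        \<le> 1 / real (Suc (Suc n)) ^ a + Z * (?v n - ?v (Suc n))"
      unfolding eq u_def[symmetric] real_norm_def abs_abs by linarith
  qed
qed

lemma zeta_power_series_sums:
  assumes "a \<ge> 2" and "b \<ge> 1" and "x \<in> {-1..<1}"
  shows "(\<lambda>n. zeta_partial (Suc n) a / real (Suc n) ^ b * x ^ Suc n) sums zeta_power_series a b x"
  unfolding zeta_power_series_def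
  by (rule summable_sums[OF sums_summable[OF bounded_variation_power_series_sums[OF
      zeta_coeff_tendsto_0[OF assms(1,2)] zeta_coeff_bounded_variation[OF assms(1,2)] assms(3)]]])

lemma zeta_power_series_continuous:
  assumes "a \<ge> 2" and "b \<ge> 1"
  shows "continuous_on {-1..<1} (zeta_power_series a b)"
  unfolding zeta_power_series_def
  by (rule bounded_variation_power_series_continuous[OF
      zeta_coeff_tendsto_0[OF assms] zeta_coeff_bounded_variation[OF assms]])

lemma Li_continuous:
  assumes "s \<ge> 2"
  shows "continuous_on {-1..<1} (Li s)"
  unfolding Li_def
proof (rule continuous_on_suminf[OF _ _ summable_inverse_power_Suc[OF assms]])
  fix n and x :: real assume "x \<in> {-1..<1}"
  then have "\<bar>(1 / real (Suc n) ^ s) * x ^ Suc n\<bar> \<le> \<bar>1 / real (Suc n) ^ s\<bar>"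
    by (intro abs_mult_power_le) auto
  then show "norm (x ^ Suc n / real (Suc n) ^ s) \<le> 1 / real (Suc n) ^ s"
    by (simp del: of_nat_Suc power_Suc)
qed (auto intro!: continuous_intros)

section \<open>Absolutely convergent series with the weights from
  \<open>log_remainder\<close>\<close>

lemma abs_log_partial_sum_le:
  fixes x :: real
  assumes "x \<in> {-1..1}"
  shows "\<bar>\<Sum>k=1..n. x ^ k / real k\<bar> \<le> 2 * sqrt (real n)"
proof (induction n)
  case (Suc n)
  \<comment> \<open>The bound grows by 2 * (s - t) in this step. Since (s - t) * (s + t) = 1 and s +
    t is at most 2 * s^2, that growth is at least 1 / (n + 1).\<close>
  define s t where "s = sqrt (real (Suc n))" and "t = sqrt (real n)"
  have s2: "s * s = real (Suc n)" "t * t = real n" by (auto simp: s_def t_def)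
  have "s \<ge> 1" "s \<ge> t" "t \<ge> 0" by (auto simp: s_def t_def)
  have "(s - t) * (s + t) = 1" using s2 by (simp add: algebra_simps)
  moreover have "(s - t) * (s + t) \<le> (s - t) * (2 * (s * s))"
  proof (rule mult_left_mono)
    have "1 * s \<le> s * s" using \<open>s \<ge> 1\<close> by (intro mult_right_mono) auto
    then show "s + t \<le> 2 * (s * s)" using \<open>s \<ge> t\<close> by linarith
  qed (use \<open>s \<ge> t\<close> in simp)
  ultimately have "1 / (s * s) \<le> 2 * (s - t)"
    using \<open>s \<ge> 1\<close> by (simp add: divide_le_eq mult_ac)
  moreover have "\<bar>x ^ Suc n / real (Suc n)\<bar> \<le> 1 / (s * s)"
    unfolding s2 using abs_mult_power_le[OF assms, of "1 / real (Suc n)" "Suc n"]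
    by (simp del: of_nat_Suc power_Suc)
  ultimately have "\<bar>x ^ Suc n / real (Suc n)\<bar> \<le> 2 * s - 2 * t" by (simp only: right_diff_distrib)
  moreover have "\<bar>\<Sum>k=1..n. x ^ k / real k\<bar> \<le> 2 * t" using Suc.IH by (simp add: t_def)
  moreover have "(\<Sum>k=1..Suc n. x ^ k / real k) = (\<Sum>k=1..n. x ^ k / real k) + x ^ Suc n / real (Suc n)"
    by simp
  ultimately show ?case unfolding s_def[symmetric] by linarith
qed simp

text \<open>One majorant serves both kinds of weight. Growth of order sqrt n is a crude bound for
  the logarithmic partial sums, but against n^(-2) it still leaves the summable power
  n^(-3/2).\<close>

lemma zeta_weighted_majorant:
  assumes "a \<ge> 2" and "b \<ge> 2"
  obtains M where "summable M" and "\<And>n y. \<bar>y\<bar> \<le> 2 * sqrt (real (Suc n)) \<Longrightarrow>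
    \<bar>zeta_partial (Suc n) a / real (Suc n) ^ b * y\<bar> \<le> M n"
proof -
  obtain Z where Z: "zeta_partial n a \<le> Z" for n using zeta_partial_bounded[OF assms(1)] by blast
  define M where "M n = 2 * Z * real (Suc n) powr (-3/2)" for n
  have "summable (\<lambda>n. real (Suc n) powr (-3/2))"
    using summable_real_powr_iff[of "-3/2"] by (subst summable_Suc_iff) simp
  then have "summable M" unfolding M_def by (rule summable_mult)
  moreover have "\<bar>zeta_partial (Suc n) a / real (Suc n) ^ b * y\<bar> \<le> M n"
    if y: "\<bar>y\<bar> \<le> 2 * sqrt (real (Suc n))" for n y
  proof -
    have "real (Suc n) ^ 2 \<le> real (Suc n) ^ b" by (intro power_increasing assms) auto
    then have "zeta_partial (Suc n) a / real (Suc n) ^ b \<le> Z / real (Suc n) ^ 2"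
      using Z[of "Suc n"] zeta_partial_nonneg[of "Suc n" a] by (intro frac_le) auto
    then have "zeta_partial (Suc n) a / real (Suc n) ^ b * \<bar>y\<bar> \<le>
        Z / real (Suc n) ^ 2 * (2 * sqrt (real (Suc n)))"
      using y Z[of "Suc n"] zeta_partial_nonneg[of "Suc n" a]
      by (intro mult_mono) (auto intro!: divide_nonneg_nonneg simp del: of_nat_Suc)
    also have "\<dots> = M n"
    proof -
      have "real (Suc n) powr (-3/2) = real (Suc n) powr (1/2 - 2)" by simp
      also have "\<dots> = sqrt (real (Suc n)) / real (Suc n) ^ 2"
        unfolding powr_diff by (simp add: powr_half_sqrt del: of_nat_Suc)
      finally show ?thesis unfolding M_def by simp
    qed
    finally show ?thesis by (simp add: abs_mult zeta_partial_nonneg del: of_nat_Suc)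
  qed
  ultimately show ?thesis using that by blast
qed

text \<open>This and \<open>zeta_log_series\<close> collect the two summands of
  \<open>log_remainder\<close>, kept apart so that \<open>ln (1 - x)\<close> can be factored out of
  the first.\<close>

definition zeta_defect_series :: "nat \<Rightarrow> nat \<Rightarrow> real \<Rightarrow> real" where
  "zeta_defect_series a b x =
    (\<Sum>n. zeta_partial (Suc n) a / real (Suc n) ^ b * (1 - x ^ Suc n))"

definition zeta_log_series :: "nat \<Rightarrow> nat \<Rightarrow> real \<Rightarrow> real" where
  "zeta_log_series a b x =
    (\<Sum>n. zeta_partial (Suc n) a / real (Suc n) ^ b * (\<Sum>k=1..Suc n. x ^ k / real k))"

lemma abs_one_minus_power_le:
  fixes x :: real
  assumes "x \<in> {-1..<1}"
  shows "\<bar>1 - x ^ Suc n\<bar> \<le> 2 * sqrt (real (Suc n))"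
proof -
  have "\<bar>x ^ Suc n\<bar> \<le> 1" using abs_mult_power_le[of x 1 "Suc n"] assms by auto
  moreover have "sqrt (real (Suc n)) \<ge> 1" by simp
  ultimately show ?thesis by linarith
qed

lemma
  assumes "a \<ge> 2" and "b \<ge> 2"
  shows zeta_defect_series_sums: "x \<in> {-1..<1} \<Longrightarrow>
      (\<lambda>n. zeta_partial (Suc n) a / real (Suc n) ^ b * (1 - x ^ Suc n)) sums zeta_defect_series a b x"
    and zeta_defect_series_continuous: "continuous_on {-1..<1} (zeta_defect_series a b)"
proof -
  obtain M where M: "summable M" and le: "\<And>n y. \<bar>y\<bar> \<le> 2 * sqrt (real (Suc n)) \<Longrightarrow>
      \<bar>zeta_partial (Suc n) a / real (Suc n) ^ b * y\<bar> \<le> M n"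
    using zeta_weighted_majorant[OF assms] by blast
  show "(\<lambda>n. zeta_partial (Suc n) a / real (Suc n) ^ b * (1 - x ^ Suc n)) sums zeta_defect_series a b x"
    if "x \<in> {-1..<1}"
    unfolding zeta_defect_series_def
    by (intro summable_sums summable_comparison_test'[OF M, where N = 0])
       (unfold real_norm_def, intro le abs_one_minus_power_le that)
  show "continuous_on {-1..<1} (zeta_defect_series a b)"
    unfolding zeta_defect_series_def
  proof (rule continuous_on_suminf[OF _ _ M])
    show "norm (zeta_partial (Suc n) a / real (Suc n) ^ b * (1 - x ^ Suc n)) \<le> M n"
      if "x \<in> {-1..<1}" for n x
      unfolding real_norm_def by (intro le abs_one_minus_power_le that)
  qed (intro continuous_intros)
qed

lemma
  assumes "a \<ge> 2" and "b \<ge> 2"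
  shows zeta_log_series_sums: "x \<in> {-1..<1} \<Longrightarrow>
      (\<lambda>n. zeta_partial (Suc n) a / real (Suc n) ^ b * (\<Sum>k=1..Suc n. x ^ k / real k))
      sums zeta_log_series a b x"
    and zeta_log_series_continuous: "continuous_on {-1..<1} (zeta_log_series a b)"
proof -
  obtain M where M: "summable M" and le: "\<And>n y. \<bar>y\<bar> \<le> 2 * sqrt (real (Suc n)) \<Longrightarrow>
      \<bar>zeta_partial (Suc n) a / real (Suc n) ^ b * y\<bar> \<le> M n"
    using zeta_weighted_majorant[OF assms] by blast
  show "(\<lambda>n. zeta_partial (Suc n) a / real (Suc n) ^ b * (\<Sum>k=1..Suc n. x ^ k / real k))
      sums zeta_log_series a b x" if "x \<in> {-1..<1}"
    unfolding zeta_log_series_def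
    by (intro summable_sums summable_comparison_test'[OF M, where N = 0])
       (unfold real_norm_def, intro le abs_log_partial_sum_le, use that in auto)
  show "continuous_on {-1..<1} (zeta_log_series a b)"
    unfolding zeta_log_series_def
  proof (rule continuous_on_suminf[OF _ _ M])
    show "norm (zeta_partial (Suc n) a / real (Suc n) ^ b * (\<Sum>k=1..Suc n. x ^ k / real k)) \<le> M n"
      if "x \<in> {-1..<1}" for n x
      unfolding real_norm_def by (intro le abs_log_partial_sum_le) (use that in auto)
    show "continuous_on {-1..<1}
        (\<lambda>x. zeta_partial (Suc n) a / real (Suc n) ^ b * (\<Sum>k=1..Suc n. x ^ k / real k))" for n
      by (intro continuous_on_mult continuous_on_const continuous_on_sum continuous_on_divide
          continuous_on_power continuous_on_id) auto
  qed
qed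

section \<open>The symmetry in expanded form, its extension to -1, and the final identity\<close>

definition expanded_moment_sum :: "nat \<Rightarrow> nat \<Rightarrow> real \<Rightarrow> real" where
  "expanded_moment_sum p q x =
    (\<Sum>i=1..q - 1. (-1) ^ (i - 1) * Li (q + 1 - i) x * zeta_power_series p i x)
    + (-1) ^ (q - 1) * (ln (1 - x) * zeta_defect_series p q x + zeta_log_series p q x)"

text \<open>Inserting \<open>moment_expansion\<close> turns each term into a finite combination of
  terms of convergent series, which can be summed separately. The resulting form, unlike the double
  series, is readily seen to be continuous at -1.\<close>

lemma zeta_moment_sums:
  assumes "p \<ge> 2" and "q \<ge> 2" and "\<bar>x\<bar> < 1"
  shows "(\<lambda>n. zeta_partial (Suc n) p * moment (Suc n) q x) sums expanded_moment_sum p q x"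
proof -
  have x: "x \<in> {-1..<1}" using assms(3) by auto
  obtain s where q: "q = Suc s" using assms(2) by (cases q) auto
  have "zeta_partial (Suc n) p * moment (Suc n) q x =
      (\<Sum>i=1..q - 1. (-1) ^ (i - 1) * Li (q + 1 - i) x *
        (zeta_partial (Suc n) p / real (Suc n) ^ i * x ^ Suc n))
      + (-1) ^ (q - 1) *
        (ln (1 - x) * (zeta_partial (Suc n) p / real (Suc n) ^ q * (1 - x ^ Suc n))
         + zeta_partial (Suc n) p / real (Suc n) ^ q * (\<Sum>k=1..Suc n. x ^ k / real k))" for n
  proof -
    have "zeta_partial (Suc n) p * (\<Sum>i=1..s. (-1) ^ (i - 1) * Li (Suc s + 1 - i) x * (x ^ Suc n / real (Suc n) ^ i))
      = (\<Sum>i=1..s. (-1) ^ (i - 1) * Li (Suc s + 1 - i) x *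
        (zeta_partial (Suc n) p / real (Suc n) ^ i * x ^ Suc n))"
      unfolding sum_distrib_left by (intro sum.cong refl) (simp del: of_nat_Suc power_Suc)
    moreover have "zeta_partial (Suc n) p * ((-1) ^ s * log_remainder (Suc n) x / real (Suc n) ^ Suc s)
      = (-1) ^ s *
        (ln (1 - x) * (zeta_partial (Suc n) p / real (Suc n) ^ Suc s * (1 - x ^ Suc n))
         + zeta_partial (Suc n) p / real (Suc n) ^ Suc s * (\<Sum>k=1..Suc n. x ^ k / real k))"
      unfolding log_remainder_def
      by (simp add: algebra_simps add_divide_distrib diff_divide_distrib
          del: of_nat_Suc power_Suc sum.cl_ivl_Suc)
    ultimately show ?thesis
      unfolding q moment_expansion[OF assms(3) zero_less_Suc] diff_Suc_1 distrib_left by simp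
  qed
  then show ?thesis
    unfolding expanded_moment_sum_def
    using assms x by (simp only:)
      (intro sums_add sums_sum sums_mult zeta_power_series_sums zeta_defect_series_sums
        zeta_log_series_sums; auto)
qed

lemma expanded_moment_sum_continuous:
  assumes "p \<ge> 2" and "q \<ge> 2"
  shows "continuous_on {-1..<1} (expanded_moment_sum p q)"
  unfolding expanded_moment_sum_def
proof (intro continuous_on_add continuous_on_sum continuous_on_mult continuous_on_const)
  show "continuous_on {-1..<1::real} (\<lambda>x. ln (1 - x))" by (intro continuous_intros) auto
  show "continuous_on {-1..<1} (Li (q + 1 - i))" if "i \<in> {1..q - 1}" for i
    using that by (intro Li_continuous) auto
  show "continuous_on {-1..<1} (zeta_power_series p i)" if "i \<in> {1..q - 1}" for i
    using that by (intro zeta_power_series_continuous assms) auto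
qed (intro zeta_defect_series_continuous zeta_log_series_continuous assms)+

text \<open>For \<open>\<bar>x\<bar> < 1\<close> both sides are sums of the same double series; at
  -1 the equality is the limit of the interior ones.\<close>

lemma expanded_moment_sum_commute:
  assumes "p \<ge> 2" and "q \<ge> 2" and x: "x \<in> {-1..<1}"
  shows "expanded_moment_sum p q x = expanded_moment_sum q p x"
proof -
  have inner: "expanded_moment_sum p q y = expanded_moment_sum q p y" if "\<bar>y\<bar> < 1" for y
    using zeta_moment_sums[OF assms(1,2) that] zeta_moment_sums[OF assms(2,1) that]
      zeta_moment_suminf_commute[OF that, of p q] by (simp add: sums_iff)
  show ?thesis
  proof (cases "x = -1")
    case False
    then show ?thesis using x by (intro inner) auto
  next
    case True
    let ?F = "at (-1 :: real) within {-1<..<1}"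
    have lim: "(expanded_moment_sum a b \<longlongrightarrow> expanded_moment_sum a b (-1)) ?F"
      if "a \<ge> 2" "b \<ge> 2" for a b
    proof -
      have "(expanded_moment_sum a b \<longlongrightarrow> expanded_moment_sum a b (-1)) (at (-1) within {-1..<1})"
        using expanded_moment_sum_continuous[OF that] by (simp add: continuous_on_def)
      then show ?thesis by (rule tendsto_within_subset) auto
    qed
    have "\<forall>\<^sub>F y in ?F. expanded_moment_sum p q y = expanded_moment_sum q p y"
      unfolding eventually_at_filter by (intro always_eventually allI impI inner) auto
    then have "(expanded_moment_sum q p \<longlongrightarrow> expanded_moment_sum p q (-1)) ?F"
      using lim[OF assms(1,2)] tendsto_cong by blast
    \<comment> \<open>Since -1 is a limit point of the open interval, the two limits along
      \<open>?F\<close> must agree.\<close>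
    moreover have "?F \<noteq> bot"
      using islimpt_greaterThanLessThan1[of "-1 :: real" 1] by (simp add: trivial_limit_within)
    ultimately show ?thesis
      unfolding True using lim[OF assms(2,1)] tendsto_unique by blast
  qed
qed

theorem theorem2p5:
  fixes p m :: nat and x :: real
  assumes "p \<ge> 2" and "x \<in> {-1..<1}"
  shows "(-1) ^ (p - 1) *
      (\<Sum>n. (zeta_partial (Suc n) (p + 2 * m) / real (Suc n) ^ p
             - zeta_partial (Suc n) p / real (Suc n) ^ (p + 2 * m))
            * (\<Sum>k=1..Suc n. x ^ k / real k))
    = (\<Sum>i=1..p + 2 * m - 1. (-1) ^ (i - 1) * Li (p + 2 * m + 1 - i) x
          * (\<Sum>n. zeta_partial (Suc n) p / real (Suc n) ^ i * x ^ Suc n))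
    - (\<Sum>i=1..p - 1. (-1) ^ (i - 1) * Li (p + 1 - i) x
          * (\<Sum>n. zeta_partial (Suc n) (p + 2 * m) / real (Suc n) ^ i * x ^ Suc n))
    + (-1) ^ p * ln (1 - x) *
      (\<Sum>n. (zeta_partial (Suc n) (p + 2 * m) / real (Suc n) ^ p
             - zeta_partial (Suc n) p / real (Suc n) ^ (p + 2 * m))
            * (1 - x ^ Suc n))"
proof -
  define q where "q = p + 2 * m"
  have q2: "q \<ge> 2" using assms(1) by (simp add: q_def)
  \<comment> \<open>The series of differences may be split because each half converges by itself,
    both exponents being at least 2.\<close>
  have L: "(\<Sum>n. (zeta_partial (Suc n) q / real (Suc n) ^ p - zeta_partial (Suc n) p / real (Suc n) ^ q)
      * (\<Sum>k=1..Suc n. x ^ k / real k)) = zeta_log_series q p x - zeta_log_series p q x"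
    unfolding left_diff_distrib
    by (intro sums_unique[symmetric] sums_diff zeta_log_series_sums assms q2)
  have U: "(\<Sum>n. (zeta_partial (Suc n) q / real (Suc n) ^ p - zeta_partial (Suc n) p / real (Suc n) ^ q)
      * (1 - x ^ Suc n)) = zeta_defect_series q p x - zeta_defect_series p q x"
    unfolding left_diff_distrib[of "zeta_partial _ _ / _"]
    by (intro sums_unique[symmetric] sums_diff zeta_defect_series_sums assms q2)
  obtain r where p: "p = Suc r" using assms(1) by (cases p) auto
  \<comment> \<open>Equal parity of \<open>p\<close> and \<open>q\<close> enters here: both
    expansions carry the same sign, so their logarithmic parts combine into the differences in
    \<open>L\<close> and \<open>U\<close>. Moving the \<open>ln (1 - x)\<close> part across then
    turns (-1)^(p-1) into (-1)^p.\<close>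
  have "(-1 :: real) ^ (q - 1) = (-1) ^ r" by (simp add: q_def p power_add power_mult)
  then show ?thesis
    using expanded_moment_sum_commute[OF assms(1) q2 assms(2)]
    unfolding q_def[symmetric] L U zeta_power_series_def[symmetric] expanded_moment_sum_def
    by (simp add: p algebra_simps)
qed

end
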